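(* If $2<p\le q<\infty$, then there exists a constant $C=C_{p,q}>0$ such that $$\left(\int_{\mathbb{D}}\left|\sum_{k=0}^\infty a_kw^k\right|^q(1-|w|^2)^{q/p'-2}\,dA(w)\right)^{1/q}\le C\left(\sum_{k=0}^\infty|a_k|^p\right)^{1/p}$$ for any sequence $(a_k)_{k=0}^\infty$ of complex numbers (the inequality being vacuous when the right-hand side is infinite).
   Context: $\mathbb{D}=\{w\in\mathbb{C}:|w|<1\}$ is the open unit disk, $dA$ denotes integration with respect to area measure on $\mathbb{C}$, and $p'=p/(p-1)$. *)

theory Defs
  imports "HOL-Analysis.Analysis"
begin

definition conj_exponent :: "real \<Rightarrow> real" where
  "conj_exponent p = p / (p - 1)"

end

theory Submission
  imports Defs
begin

text \<open>
  Put \<open>\<sigma> = 1 - |w|\<^sup>2\<close>. Since \<open>\<sigma>\<^bsup>1/p'\<^esup> |f(w)|\<close> is bounded by a multiple of the \<open>\<ell>\<^sup>p\<close> norm of the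
  coefficients, it suffices to treat \<open>q = p\<close>, where the weight is \<open>\<sigma>\<^bsup>p-3\<^esup>\<close>. This case is a
  Marcinkiewicz interpolation between \<open>\<ell>\<^sup>2 \<rightarrow> L\<^sup>2\<close> (Parseval, applied to the rotations of
  \<open>w\<close> by roots of unity) and a weighted sup bound, with the coefficient sequence cut at heights
  proportional to \<open>\<surd>\<sigma> |w|\<^sup>k / \<surd>(k + 1)\<close>. The factor \<open>(k + 1)\<^bsup>-1/2\<^esup>\<close> in the heights is what
  makes the remaining radial integrals \<open>(k + 1)\<^bsup>\<eta>\<^esup> \<integral> \<sigma>\<^bsup>\<eta>-1\<^esup> (1 - \<sigma>)\<^sup>k d\<sigma>\<close>, \<open>\<eta> = (p - 2)/2\<close>,
  uniformly bounded; a cut at heights \<open>\<sigma> |w|\<^sup>k\<close> would lead to the divergent case \<open>\<eta> = 0\<close>.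
\<close>

section \<open>Discrete estimates: averages over roots of unity and the total of the cut
  heights\<close>

text \<open>Orthogonality of the characters of the cyclic group of order \<open>n\<close>. There are
  as many roots as coefficients, so distinct \<open>k < n\<close> give distinct characters and all
  cross terms vanish.\<close>

lemma sum_norm_power2_roots_of_unity:
  fixes b :: "nat \<Rightarrow> complex" and n :: nat
  defines "\<zeta> \<equiv> cis (2 * pi / n)"
  assumes n: "n > 0"
  shows "(\<Sum>j<n. (norm (\<Sum>k<n. b k * \<zeta> ^ (j * k)))\<^sup>2) = n * (\<Sum>k<n. (norm (b k))\<^sup>2)"
proof -
  have z1: "\<zeta> * cnj \<zeta> = 1"
    by (simp add: \<zeta>_def complex_norm_square [symmetric])
  have pw: "\<zeta> ^ k = cis (2 * pi * real k / real n)" for k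
    by (simp add: \<zeta>_def Complex.DeMoivre field_simps)
  have orth: "(\<Sum>j<n. \<zeta> ^ (j * k) * cnj (\<zeta> ^ (j * l))) = (if k = l then of_nat n else 0)"
    if "k < n" "l < n" for k l
  proof -
    \<comment> \<open>The inner sum is geometric with ratio \<open>u\<close>; as
      \<open>u ^ n = 1\<close>, it vanishes unless \<open>u = 1\<close>.\<close>
    define u where "u = \<zeta> ^ k * cnj (\<zeta> ^ l)"
    have eq: "(\<Sum>j<n. \<zeta> ^ (j * k) * cnj (\<zeta> ^ (j * l))) = (\<Sum>j<n. u ^ j)"
      unfolding u_def
      by (intro sum.cong refl) (simp add: power_mult_distrib power_mult [symmetric] mult.commute)
    have zn: "\<zeta> ^ n = 1"
      using n by (simp add: pw)
    have un: "u ^ n = 1"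
    proof -
      have "u ^ n = (\<zeta> ^ n) ^ k * cnj ((\<zeta> ^ n) ^ l)"
        by (simp add: u_def power_mult_distrib power_mult [symmetric] mult.commute)
      then show ?thesis by (simp add: zn)
    qed
    have u1: "u = 1 \<longleftrightarrow> k = l"
    proof
      assume "u = 1"
      then have "\<zeta> ^ k * (cnj \<zeta> * \<zeta>) ^ l = \<zeta> ^ l"
        by (simp add: u_def power_mult_distrib mult.assoc [symmetric])
      then have "\<zeta> ^ k = \<zeta> ^ l"
        using z1 by (simp add: mult.commute)
      then show "k = l"
        using bij_betw_imp_inj_on [OF Complex.bij_betw_roots_unity [OF n]] that
        by (auto simp: pw inj_on_def)
    next
      assume "k = l"
      then show "u = 1"
        using z1 by (simp add: u_def power_mult_distrib [symmetric])
    qed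
    show ?thesis
      unfolding eq using u1 un by (auto simp: sum_gp_strict)
  qed
  have "complex_of_real (\<Sum>j<n. (norm (\<Sum>k<n. b k * \<zeta> ^ (j * k)))\<^sup>2)
      = (\<Sum>j<n. \<Sum>k<n. \<Sum>l<n. b k * cnj (b l) * (\<zeta> ^ (j * k) * cnj (\<zeta> ^ (j * l))))"
    unfolding of_real_sum complex_norm_square
    by (simp add: sum_product mult_ac)
  also have "\<dots> = (\<Sum>k<n. \<Sum>l<n. \<Sum>j<n. b k * cnj (b l) * (\<zeta> ^ (j * k) * cnj (\<zeta> ^ (j * l))))"
    by (subst sum.swap, rule sum.cong [OF refl], rule sum.swap)
  also have "\<dots> = (\<Sum>k<n. \<Sum>l<n. b k * cnj (b l) * (if k = l then of_nat n else 0))"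
    by (intro sum.cong refl) (simp add: sum_distrib_left [symmetric] orth del: complex_cnj_power)
  also have "\<dots> = (\<Sum>k<n. complex_of_real (n * (norm (b k))\<^sup>2))"
    by (intro sum.cong refl) (simp add: complex_norm_square [symmetric] if_distrib [of "(*) _"] cong: if_cong)
  also have "\<dots> = complex_of_real (n * (\<Sum>k<n. (norm (b k))\<^sup>2))"
    by (simp add: sum_distrib_left)
  finally show ?thesis
    by (simp only: of_real_eq_iff)
qed

text \<open>
  Integrating over the level \<open>\<mu>\<close> gives
  \<open>|F|\<^sup>p = |F|\<^sup>2 \<integral> 1\<close> over \<open>0 < \<mu> < |F|\<^bsup>p-2\<^esup>\<close>; at level \<open>\<mu>\<close> the coefficients with
  \<open>|b\<^sub>k| \<le> \<mu>\<^bsup>1/(p-2)\<^esup> M\<^sub>k\<close> contribute at most \<open>|F|/2\<close>, so that Parseval for the others suffices.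
\<close>

lemma sum_norm_powr_roots_of_unity_le:
  fixes b :: "nat \<Rightarrow> complex" and M :: "nat \<Rightarrow> real" and n :: nat and p :: real
  defines "\<zeta> \<equiv> cis (2 * pi / n)"
  assumes n: "n > 0" and p: "p > 2"
    and M: "\<And>k. k < n \<Longrightarrow> M k > 0" and M_sum: "(\<Sum>k<n. M k) \<le> 1 / 2"
  shows "(\<Sum>j<n. norm (\<Sum>k<n. b k * \<zeta> ^ (j * k)) powr p)
      \<le> 4 * n * (\<Sum>k<n. (norm (b k))\<^sup>2 * (norm (b k) / M k) powr (p - 2))"
proof -
  define F where "F j = (\<Sum>k<n. b k * \<zeta> ^ (j * k))" for j
  define c where "c k = (norm (b k) / M k) powr (p - 2)" for k
  \<comment> \<open>\<open>t \<mu>\<close> keeps the large coefficients only: for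
    \<open>\<mu> > 0\<close>, \<open>\<mu> < c k\<close> says that \<open>norm (b k)\<close> exceeds
    \<open>\<mu> powr (1 / (p - 2)) * M k\<close>.\<close>
  define t where "t \<mu> k = (if \<mu> < c k then b k else 0)" for \<mu> k
  have nz: "norm \<zeta> = 1" by (simp add: \<zeta>_def)
  have cut: "(norm (F j))\<^sup>2 * indicator {0<..<norm (F j) powr (p - 2)} \<mu>
      \<le> 4 * (norm (\<Sum>k<n. t \<mu> k * \<zeta> ^ (j * k)))\<^sup>2" for j and \<mu> :: real
  proof (cases "\<mu> \<in> {0<..<norm (F j) powr (p - 2)}")
    case True
    define l where "l = \<mu> powr (1 / (p - 2))"
    have l0: "l > 0" and lmu: "l powr (p - 2) = \<mu>"
      using True p by (auto simp: l_def powr_powr)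
    have lF: "l < norm (F j)"
    proof (rule ccontr)
      assume "\<not> l < norm (F j)"
      then have "norm (F j) powr (p - 2) \<le> l powr (p - 2)"
        using p by (intro powr_mono2) auto
      with True lmu show False by simp
    qed
    have small: "norm (b k - t \<mu> k) \<le> l * M k" if "k < n" for k
    proof (cases "\<mu> < c k")
      case True
      then show ?thesis using l0 M [OF that] by (simp add: t_def)
    next
      case False
      have "norm (b k) / M k \<le> l"
      proof (rule ccontr)
        assume "\<not> norm (b k) / M k \<le> l"
        then have "l powr (p - 2) < (norm (b k) / M k) powr (p - 2)"
          using p l0 by (intro powr_less_mono2) auto
        with False lmu show False by (simp add: c_def)
      qed
      then show ?thesis using False M [OF that] by (simp add: t_def field_simps)
    qed
    \<comment> \<open>The discarded coefficients add up to at most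
      \<open>l / 2 < norm (F j) / 2\<close>, so the kept part has norm at least
      \<open>norm (F j) / 2\<close>; squaring produces the factor 4.\<close>
    have "norm (F j - (\<Sum>k<n. t \<mu> k * \<zeta> ^ (j * k))) = norm (\<Sum>k<n. (b k - t \<mu> k) * \<zeta> ^ (j * k))"
      by (simp add: F_def sum_subtractf [symmetric] algebra_simps)
    also have "\<dots> \<le> (\<Sum>k<n. l * M k)"
      using small by (intro sum_norm_le) (simp add: norm_mult norm_power nz)
    also have "\<dots> \<le> l / 2"
      using mult_left_mono [OF M_sum, of l] l0 by (simp add: sum_distrib_left)
    finally have "norm (F j) - norm (\<Sum>k<n. t \<mu> k * \<zeta> ^ (j * k)) \<le> norm (F j) / 2"
      using lF norm_triangle_ineq2 [of "F j" "\<Sum>k<n. t \<mu> k * \<zeta> ^ (j * k)"] by linarith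
    then have "norm (F j) \<le> 2 * norm (\<Sum>k<n. t \<mu> k * \<zeta> ^ (j * k))"
      by simp
    then have "(norm (F j))\<^sup>2 \<le> (2 * norm (\<Sum>k<n. t \<mu> k * \<zeta> ^ (j * k)))\<^sup>2"
      by (intro power_mono) auto
    then show ?thesis using True by (simp add: power_mult_distrib)
  qed simp
  \<comment> \<open>For \<open>\<mu> \<le> 0\<close> all indicators vanish. For
    \<open>\<mu> > 0\<close> the truncation condition \<open>\<mu> < c k\<close> coincides with the
    indicator of \<open>{0<..<c k}\<close>, so Parseval for \<open>t \<mu>\<close> gives the
    right-hand side.\<close>
  have key: "(\<Sum>j<n. (norm (F j))\<^sup>2 * indicator {0<..<norm (F j) powr (p - 2)} \<mu>)
      \<le> 4 * n * (\<Sum>k<n. (norm (b k))\<^sup>2 * indicator {0<..<c k} \<mu>)" for \<mu> :: real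
  proof (cases "\<mu> > 0")
    case True
    have "(\<Sum>j<n. (norm (F j))\<^sup>2 * indicator {0<..<norm (F j) powr (p - 2)} \<mu>)
        \<le> (\<Sum>j<n. 4 * (norm (\<Sum>k<n. t \<mu> k * \<zeta> ^ (j * k)))\<^sup>2)"
      by (intro sum_mono cut)
    also have "\<dots> = 4 * (n * (\<Sum>k<n. (norm (t \<mu> k))\<^sup>2))"
      using sum_norm_power2_roots_of_unity [OF n, of "t \<mu>"]
      by (simp add: sum_distrib_left [symmetric] \<zeta>_def)
    also have "(\<Sum>k<n. (norm (t \<mu> k))\<^sup>2) = (\<Sum>k<n. (norm (b k))\<^sup>2 * indicator {0<..<c k} \<mu>)"
      using True by (intro sum.cong refl) (simp add: t_def)
    finally show ?thesis by simp
  qed (simp add: sum_nonneg)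
  have int: "integrable lborel (indicator {0<..<x} :: real \<Rightarrow> real)"
    and val: "0 \<le> x \<Longrightarrow> integral\<^sup>L lborel (indicator {0<..<x} :: real \<Rightarrow> real) = x" for x :: real
    by (cases "0 \<le> x", auto)
  have "(\<Sum>j<n. (norm (F j))\<^sup>2 * norm (F j) powr (p - 2))
      = (LINT \<mu>|lborel. (\<Sum>j<n. (norm (F j))\<^sup>2 * indicator {0<..<norm (F j) powr (p - 2)} \<mu>))"
    by (subst Bochner_Integration.integral_sum) (simp_all add: int val)
  also have "\<dots> \<le> (LINT \<mu>|lborel. 4 * n * (\<Sum>k<n. (norm (b k))\<^sup>2 * indicator {0<..<c k} \<mu>))"
    by (intro integral_mono key Bochner_Integration.integrable_sum integrable_mult_right int)
  also have "\<dots> = 4 * n * (\<Sum>k<n. (norm (b k))\<^sup>2 * c k)"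
    by (subst integral_mult_right_zero, subst Bochner_Integration.integral_sum)
      (simp_all add: int val c_def)
  also have "(\<lambda>j. (norm (F j))\<^sup>2 * norm (F j) powr (p - 2)) = (\<lambda>j. norm (F j) powr p)"
  proof
    fix j
    show "(norm (F j))\<^sup>2 * norm (F j) powr (p - 2) = norm (F j) powr p"
      using p by (cases "F j = 0") (simp_all add: powr_diff)
  qed
  finally show ?thesis by (simp add: F_def c_def)
qed

text \<open>Split at \<open>k\<close> about \<open>1 / (1 - r)\<close>. Before that,
  \<open>r ^ k \<le> 1\<close> and the inverse square roots telescope to twice a square root;
  afterwards they are at most \<open>sqrt (1 - r)\<close> and the geometric series takes over. This
  controls the sum of the cut heights.\<close>

lemma sum_power_div_sqrt_le:
  fixes r :: real
  assumes "0 \<le> r" "r < 1"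
  shows "(\<Sum>k<n. r ^ k / sqrt (k + 1)) \<le> 3 / sqrt (1 - r)"
proof -
  define s where "s = 1 - r"
  define N where "N = nat \<lfloor>1 / s\<rfloor>"
  have s: "0 < s" "s \<le> 1" using assms by (auto simp: s_def)
  have N1: "real N \<le> 1 / s" and N2: "1 / s < real N + 1"
    using s by (auto simp: N_def)
  have tele: "1 / sqrt (k + 1) \<le> 2 * (sqrt (k + 1) - sqrt k)" for k :: nat
  proof -
    have "sqrt k \<le> sqrt (k + 1)" by simp
    then have "(sqrt (k + 1) - sqrt k) * (sqrt (k + 1) + sqrt k)
        \<le> (sqrt (k + 1) - sqrt k) * (2 * sqrt (k + 1))"
      by (intro mult_left_mono) auto
    also have "(sqrt (k + 1) - sqrt k) * (sqrt (k + 1) + sqrt k) = 1"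
      by (simp add: algebra_simps)
    finally show ?thesis by (simp add: field_simps)
  qed
  have "r ^ k / sqrt (k + 1)
      \<le> (if k < N then 2 * (sqrt (k + 1) - sqrt k) else 0) + sqrt s * r ^ k" for k
  proof (cases "k < N")
    case True
    have "r ^ k / sqrt (k + 1) \<le> 1 / sqrt (k + 1)"
      using assms by (intro divide_right_mono) (auto simp: power_le_one)
    moreover have "0 \<le> sqrt s * r ^ k" using s assms by simp
    ultimately show ?thesis using True tele [of k] by simp
  next
    case False
    then have "1 / s \<le> real k + 1" using N2 by linarith
    then have "sqrt (1 / s) \<le> sqrt (k + 1)" by simp
    then have "1 / sqrt (k + 1) \<le> sqrt s"
      using s by (simp add: real_sqrt_divide field_simps)
    then have "r ^ k * (1 / sqrt (k + 1)) \<le> r ^ k * sqrt s"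
      using assms by (intro mult_left_mono) auto
    then show ?thesis using False by (simp add: mult.commute)
  qed
  then have "(\<Sum>k<n. r ^ k / sqrt (k + 1))
      \<le> (\<Sum>k<n. (if k < N then 2 * (sqrt (k + 1) - sqrt k) else 0) + sqrt s * r ^ k)"
    by (intro sum_mono)
  also have "\<dots> = (\<Sum>k<n. if k < N then 2 * (sqrt (k + 1) - sqrt k) else 0) + sqrt s * (\<Sum>k<n. r ^ k)"
    by (simp add: sum.distrib sum_distrib_left)
  also have "(\<Sum>k<n. if k < N then 2 * (sqrt (k + 1) - sqrt k) else 0)
      = (\<Sum>k\<in>{..<n} \<inter> {..<N}. 2 * (sqrt (k + 1) - sqrt k))"
    by (subst sum.inter_restrict) auto
  also have "\<dots> \<le> (\<Sum>k<N. 2 * (sqrt (k + 1) - sqrt k))"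
    by (intro sum_mono2) auto
  also have "\<dots> = 2 * sqrt N"
    using sum_lessThan_telescope [of "\<lambda>k. sqrt (real k)" N]
    by (simp add: sum_distrib_left [symmetric] add.commute del: right_diff_distrib_numeral)
  also have "\<dots> \<le> 2 * sqrt (1 / s)"
    using N1 by simp
  also have "(\<Sum>k<n. r ^ k) \<le> 1 / s"
    using assms s by (simp add: sum_gp_strict s_def divide_right_mono)
  finally have "(\<Sum>k<n. r ^ k / sqrt (k + 1)) \<le> 2 * sqrt (1 / s) + sqrt s * (1 / s)"
    using s by (simp add: mult_left_mono)
  also have "\<dots> = 3 / sqrt s"
    using s by (simp add: real_sqrt_divide field_simps)
  finally show ?thesis by (simp add: s_def)
qed

section \<open>Rotation invariance and radial integrals over the disc\<close>

text \<open>Uniqueness of Haar measure: convolve with the indicator of a ball and swap the integrals.\<close>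

lemma nn_integral_lborel_rotation:
  fixes c :: complex and G :: "complex \<Rightarrow> ennreal"
  assumes G [measurable]: "G \<in> borel_measurable borel" and c: "norm c = 1"
  shows "(\<integral>\<^sup>+w. G (c * w) \<partial>lborel) = (\<integral>\<^sup>+w. G w \<partial>lborel)"
proof -
  have trans: "(\<integral>\<^sup>+x. h (v + x) \<partial>lborel) = (\<integral>\<^sup>+x. h x \<partial>lborel)"
    if [measurable]: "h \<in> borel_measurable borel" for h :: "complex \<Rightarrow> ennreal" and v
    by (subst (2) lborel_distr_plus [of v, symmetric]) (simp add: nn_integral_distr)
  define B where "B = emeasure lborel (cball 0 1 :: complex set)"
  have B: "B \<noteq> 0" "B \<noteq> \<infinity>"
    by (auto simp: B_def emeasure_cball unit_ball_vol_numeral)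
  have [measurable]: "cball 0 1 \<in> sets (borel :: complex measure)" by simp
  have c0: "c \<noteq> 0" using c by auto
  have "B * (\<integral>\<^sup>+w. G (c * w) \<partial>lborel)
      = (\<integral>\<^sup>+y. indicator (cball (0 :: complex) 1) y * (\<integral>\<^sup>+x. G (c * x) \<partial>lborel) \<partial>lborel)"
    by (subst nn_integral_multc) (simp_all add: B_def)
  also have "\<dots> = (\<integral>\<^sup>+y. (\<integral>\<^sup>+x. indicator (cball 0 1) y * G (c * x + y) \<partial>lborel) \<partial>lborel)"
  proof (rule nn_integral_cong)
    fix y
    \<comment> \<open>Translating \<open>x\<close> by \<open>y / c\<close> brings the ball variable
      \<open>y\<close> into the argument of \<open>G\<close>.\<close>
    have "(\<integral>\<^sup>+x. G (c * x) \<partial>lborel) = (\<integral>\<^sup>+x. G (c * (y / c + x)) \<partial>lborel)"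
      by (rule trans [symmetric]) simp
    also have "\<dots> = (\<integral>\<^sup>+x. G (c * x + y) \<partial>lborel)"
      using c0 by (simp add: algebra_simps)
    finally show "indicator (cball 0 1) y * (\<integral>\<^sup>+x. G (c * x) \<partial>lborel)
        = (\<integral>\<^sup>+x. indicator (cball 0 1) y * G (c * x + y) \<partial>lborel)"
      by (simp add: nn_integral_cmult)
  qed
  also have "\<dots> = (\<integral>\<^sup>+x. (\<integral>\<^sup>+y. indicator (cball 0 1) y * G (c * x + y) \<partial>lborel) \<partial>lborel)"
    by (intro lborel_pair.Fubini') simp
  also have "\<dots> = (\<integral>\<^sup>+x. (\<integral>\<^sup>+y. indicator (cball 0 1) (y - c * x) * G y \<partial>lborel) \<partial>lborel)"
  proof (rule nn_integral_cong)
    fix x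
    show "(\<integral>\<^sup>+y. indicator (cball 0 1) y * G (c * x + y) \<partial>lborel)
        = (\<integral>\<^sup>+y. indicator (cball 0 1) (y - c * x) * G y \<partial>lborel)"
      using trans [of "\<lambda>y. indicator (cball 0 1) (y - c * x) * G y" "c * x"] by simp
  qed
  also have "\<dots> = (\<integral>\<^sup>+y. (\<integral>\<^sup>+x. indicator (cball 0 1) (y - c * x) * G y \<partial>lborel) \<partial>lborel)"
    by (intro lborel_pair.Fubini') simp
  also have "\<dots> = (\<integral>\<^sup>+y. B * G y \<partial>lborel)"
  proof (rule nn_integral_cong)
    fix y
    \<comment> \<open>Here \<open>norm c = 1\<close> enters: the set of admissible \<open>x\<close>
      is again a unit ball, whose measure is \<open>B\<close> whatever its centre.\<close>
    have "y - c * x \<in> cball 0 1 \<longleftrightarrow> x \<in> cball (y / c) 1" for x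
    proof -
      have "norm (y - c * x) = norm (c * (y / c - x))"
        using c0 by (simp add: algebra_simps)
      then show ?thesis by (simp add: norm_mult c dist_norm norm_minus_commute)
    qed
    then have "(\<integral>\<^sup>+x. indicator (cball 0 1) (y - c * x) * G y \<partial>lborel)
        = (\<integral>\<^sup>+x. indicator (cball (y / c) 1) x * G y \<partial>lborel)"
      by (simp add: indicator_def)
    also have "\<dots> = B * G y"
      by (subst nn_integral_multc) (simp_all add: B_def emeasure_cball borel_measurable_indicator)
    finally show "(\<integral>\<^sup>+x. indicator (cball 0 1) (y - c * x) * G y \<partial>lborel) = B * G y" .
  qed
  also have "\<dots> = B * (\<integral>\<^sup>+y. G y \<partial>lborel)"
    by (simp add: nn_integral_cmult)
  finally show ?thesis
    using B by (simp add: ennreal_mult_cancel_left)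
qed

text \<open>A disc of radius \<open>sqrt (1 - x)\<close> has area \<open>pi * (1 - x)\<close>, which
  is affine in \<open>x\<close>. Hence the image of area measure on the disc under
  \<open>1 - (norm w)\<^sup>2\<close> is \<open>pi\<close> times Lebesgue measure on the unit
  interval; comparing both measures on half-lines proves it.\<close>

lemma nn_integral_disc_radial:
  fixes h :: "real \<Rightarrow> ennreal"
  assumes [measurable]: "h \<in> borel_measurable borel"
  shows "(\<integral>\<^sup>+w. h (1 - (norm w)\<^sup>2) * indicator (ball (0 :: complex) 1) w \<partial>lborel)
      = pi * (\<integral>\<^sup>+s. h s * indicator {0<..1} s \<partial>lborel)"
proof -
  define M where "M = distr (density lborel (indicator (ball (0 :: complex) 1))) borel (\<lambda>w. 1 - (norm w)\<^sup>2)"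
  define N where "N = density lborel (\<lambda>s :: real. ennreal pi * indicator {0<..1} s)"
  have [measurable]: "ball 0 1 \<in> sets (borel :: complex measure)" by simp
  \<comment> \<open>The \<open>max 0 x\<close> covers negative \<open>x\<close>, where the condition
    is void and the whole disc remains.\<close>
  have set: "ball (0 :: complex) 1 \<inter> {w. x < 1 - (norm w)\<^sup>2} = (if x < 1 then ball 0 (sqrt (1 - max 0 x)) else {})"
    for x :: real
  proof -
    have "norm w < 1 \<and> x < 1 - (norm w)\<^sup>2 \<longleftrightarrow> x < 1 \<and> norm w < sqrt (1 - max 0 x)" for w :: complex
    proof (cases "x < 1")
      case True
      have a: "norm w < 1 \<longleftrightarrow> (norm w)\<^sup>2 < 1"
        using power_less_one_iff [of "norm w" 2] by simp
      have "norm w < sqrt (1 - max 0 x) \<longleftrightarrow> (norm w)\<^sup>2 < 1 - max 0 x"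
        by (metis real_sqrt_less_iff real_sqrt_power norm_ge_zero real_sqrt_abs abs_of_nonneg)
      then show ?thesis using True a by auto
    next
      case False
      have "0 \<le> (norm w)\<^sup>2" by simp
      then show ?thesis using False by linarith
    qed
    then show ?thesis by (auto simp: set_eq_iff)
  qed
  have eM: "emeasure M {x<..} = ennreal (if x < 1 then pi * (1 - max 0 x) else 0)" for x
  proof -
    have "emeasure M {x<..} = emeasure lborel (ball (0 :: complex) 1 \<inter> {w. x < 1 - (norm w)\<^sup>2})"
      unfolding M_def
      by (subst emeasure_distr)
        (simp_all add: vimage_def emeasure_density indicator_inter_arith [symmetric] borel_measurable_indicator)
    then show ?thesis
      unfolding set by (auto simp: emeasure_ball unit_ball_vol_numeral max_def)
  qed
  have eN: "emeasure N {x<..} = ennreal (if x < 1 then pi * (1 - max 0 x) else 0)" for x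
  proof -
    have "emeasure N {x<..} = (\<integral>\<^sup>+s. ennreal pi * indicator {max 0 x<..1} s \<partial>lborel)"
      unfolding N_def by (subst emeasure_density)
        (auto intro!: nn_integral_cong split: split_indicator)
    also have "\<dots> = ennreal pi * emeasure lborel {max 0 x<..1}"
      by (subst nn_integral_cmult) auto
    also have "\<dots> = ennreal (if x < 1 then pi * (1 - max 0 x) else 0)"
      by (cases "x < 1") (auto simp: ennreal_mult')
    finally show ?thesis .
  qed
  have "M = N"
    by (rule measure_eqI_lessThan) (simp_all add: eM eN, simp_all add: M_def N_def)
  then have "(\<integral>\<^sup>+s. h s \<partial>M) = (\<integral>\<^sup>+s. h s \<partial>N)" by simp
  then show ?thesis
    unfolding M_def N_def
    by (simp add: nn_integral_distr nn_integral_density nn_integral_cmult [symmetric] mult_ac)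
qed

text \<open>The inequality \<open>1 - s \<le> exp (- s)\<close> and the substitution
  \<open>t = (k + 1) * s\<close> reduce the Beta integral to the Gamma integral. The factor
  \<open>exp 1\<close> pays for replacing \<open>k\<close> by \<open>k + 1\<close> in the exponent,
  since \<open>s \<le> 1\<close>.\<close>

lemma nn_integral_Beta_le:
  fixes \<eta> :: real and k :: nat
  assumes \<eta>: "\<eta> > 0"
  shows "(\<integral>\<^sup>+s. ennreal (s powr (\<eta> - 1) * (1 - s) ^ k) * indicator {0<..1} s \<partial>lborel)
      \<le> ennreal (exp 1 * Gamma \<eta> * (k + 1) powr - \<eta>)"
proof -
  define K where "K = real k + 1"
  have K: "K > 0" by (simp add: K_def)
  define g where "g t = ennreal (indicator {0..} t * t powr (\<eta> - 1) / exp t)" for t :: real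
  have [measurable]: "g \<in> borel_measurable borel" unfolding g_def by measurable
  have "(\<integral>\<^sup>+s. ennreal (s powr (\<eta> - 1) * (1 - s) ^ k) * indicator {0<..1} s \<partial>lborel)
      \<le> (\<integral>\<^sup>+s. ennreal (exp 1 * K powr (1 - \<eta>)) * g (0 + K * s) \<partial>lborel)"
  proof (rule nn_integral_mono)
    fix s :: real
    show "ennreal (s powr (\<eta> - 1) * (1 - s) ^ k) * indicator {0<..1} s
        \<le> ennreal (exp 1 * K powr (1 - \<eta>)) * g (0 + K * s)"
    proof (cases "s \<in> {0<..1}")
      case True
      have "(1 - s) ^ k \<le> exp (- s) ^ k"
        using True exp_ge_add_one_self [of "- s"] by (intro power_mono) auto
      also have "\<dots> = exp (s - K * s)"
        by (simp add: K_def exp_of_nat_mult [symmetric] algebra_simps)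
      also have "\<dots> \<le> exp (1 - K * s)" using True by simp
      finally have "s powr (\<eta> - 1) * (1 - s) ^ k \<le> s powr (\<eta> - 1) * exp (1 - K * s)"
        by (intro mult_left_mono) auto
      also have "\<dots> = (exp 1 * K powr (1 - \<eta>)) * ((K * s) powr (\<eta> - 1) / exp (K * s))"
        using True K by (simp add: powr_mult exp_diff powr_diff)
      finally show ?thesis
        using True K by (simp add: g_def ennreal_mult' [symmetric] ennreal_leI)
    qed simp
  qed
  also have "\<dots> = ennreal (exp 1 * K powr (1 - \<eta>)) * (\<integral>\<^sup>+s. g (0 + K * s) \<partial>lborel)"
    by (rule nn_integral_cmult) simp
  also have "(\<integral>\<^sup>+s. g (0 + K * s) \<partial>lborel) = ennreal (1 / K) * (\<integral>\<^sup>+t. g t \<partial>lborel)"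
    using K by (subst nn_integral_real_affine [of g K 0])
      (auto simp: mult.assoc [symmetric] ennreal_mult' [symmetric])
  also have "(\<integral>\<^sup>+t. g t \<partial>lborel) = ennreal (Gamma \<eta>)"
    unfolding g_def using Gamma_conv_nn_integral_real [OF \<eta>] by simp
  also have "ennreal (exp 1 * K powr (1 - \<eta>)) * (ennreal (1 / K) * ennreal (Gamma \<eta>))
      = ennreal (exp 1 * Gamma \<eta> * K powr - \<eta>)"
    using K \<eta> Gamma_real_pos [OF \<eta>]
    by (simp add: ennreal_mult' [symmetric] powr_diff powr_minus field_simps)
  finally show ?thesis by (simp add: K_def add.commute)
qed

section \<open>The case \<open>q = p\<close> for polynomials\<close>

text \<open>Rotations preserve the disc, the radial weight and area measure. A pointwise estimate
  for the sum over \<open>n\<close> rotations therefore yields an integral estimate for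
  \<open>f\<close> itself.\<close>

lemma nn_integral_disc_rotation_average:
  fixes f :: "complex \<Rightarrow> complex" and u :: "real \<Rightarrow> real" and n :: nat
  defines "\<zeta> \<equiv> cis (2 * pi / n)"
  assumes [measurable]: "f \<in> borel_measurable borel" "u \<in> borel_measurable borel"
    and n: "n > 0" and u: "\<And>s. u s \<ge> 0"
  shows "n * (\<integral>\<^sup>+w. ennreal (norm (f w) powr p * u (norm w)) * indicator (ball 0 1) w \<partial>lborel)
    = (\<integral>\<^sup>+w. ennreal ((\<Sum>j<n. norm (f (\<zeta> ^ j * w)) powr p) * u (norm w)) * indicator (ball 0 1) w \<partial>lborel)"
proof -
  define G where "G w = ennreal (norm (f w) powr p * u (norm w)) * indicator (ball 0 1) w" for w
  have [measurable]: "ball 0 1 \<in> sets (borel :: complex measure)" by simp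
  have [measurable]: "G \<in> borel_measurable borel" unfolding G_def by measurable
  have nz: "norm (\<zeta> ^ j) = 1" for j by (simp add: \<zeta>_def norm_power)
  have "(\<integral>\<^sup>+w. ennreal ((\<Sum>j<n. norm (f (\<zeta> ^ j * w)) powr p) * u (norm w)) * indicator (ball 0 1) w \<partial>lborel)
      = (\<integral>\<^sup>+w. (\<Sum>j<n. G (\<zeta> ^ j * w)) \<partial>lborel)"
  proof (rule nn_integral_cong)
    fix w
    have "indicator (ball 0 1) (\<zeta> ^ j * w) = (indicator (ball 0 1) w :: ennreal)" for j
      using nz [of j] by (simp add: indicator_def norm_mult)
    then show "ennreal ((\<Sum>j<n. norm (f (\<zeta> ^ j * w)) powr p) * u (norm w)) * indicator (ball 0 1) w
        = (\<Sum>j<n. G (\<zeta> ^ j * w))"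
      using nz u by (simp add: G_def norm_mult sum_distrib_right [symmetric] sum_ennreal)
  qed
  also have "\<dots> = (\<Sum>j<n. \<integral>\<^sup>+w. G (\<zeta> ^ j * w) \<partial>lborel)"
    by (rule nn_integral_sum) simp
  also have "\<dots> = n * (\<integral>\<^sup>+w. G w \<partial>lborel)"
    using nz by (simp add: nn_integral_lborel_rotation ennreal_of_nat_eq_real_of_nat)
  finally show ?thesis by (simp add: G_def)
qed

text \<open>The number of rotations is taken equal to the number of coefficients. It appears as a
  factor on both sides and cancels, so the constant is independent of \<open>n\<close>, as the later
  passage to the limit requires.\<close>

lemma nn_integral_disc_polynomial_le:
  fixes a :: "nat \<Rightarrow> complex" and p :: real and n :: nat
  assumes p: "p > 2"
  shows "(\<integral>\<^sup>+w. ennreal (norm (\<Sum>k<n. a k * w ^ k) powr p * (1 - (norm w)\<^sup>2) powr (p - 3))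
        * indicator (ball 0 1) w \<partial>lborel)
      \<le> ennreal (4 * 12 powr (p - 2) * pi * exp 1 * Gamma ((p - 2) / 2) * (\<Sum>k<n. norm (a k) powr p))"
proof (cases "n = 0")
  case True
  then show ?thesis by simp
next
  case False
  then have n: "n > 0" by simp
  define \<eta> where "\<eta> = (p - 2) / 2"
  have \<eta>: "\<eta> > 0" using p by (simp add: \<eta>_def)
  define \<zeta> where "\<zeta> = cis (2 * pi / n)"
  define f where "f w = (\<Sum>k<n. a k * w ^ k)" for w
  have [measurable]: "f \<in> borel_measurable borel" unfolding f_def by measurable
  have [measurable]: "ball 0 1 \<in> sets (borel :: complex measure)" by simp
  \<comment> \<open>The 4 comes from the interpolation over roots of unity, the 12 from the
    normalisation of the heights \<open>M k\<close> below.\<close>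
  define B where "B = 4 * 12 powr (p - 2)"
  have B: "B > 0" by (simp add: B_def)
  define \<alpha> where "\<alpha> k = norm (a k) powr p * (k + 1) powr \<eta>" for k :: nat
  \<comment> \<open>The form \<open>1 - (1 - (norm w)\<^sup>2)\<close> makes each summand visibly a
    function of \<open>1 - (norm w)\<^sup>2\<close>, ready for
    \<open>nn_integral_disc_radial\<close>. Excluding the null set \<open>w = 0\<close> keeps all
    heights \<open>M k\<close> positive.\<close>
  have ptw: "(\<Sum>j<n. norm (f (\<zeta> ^ j * w)) powr p) * (1 - (norm w)\<^sup>2) powr (p - 3)
      \<le> n * (B * (\<Sum>k<n. \<alpha> k * ((1 - (norm w)\<^sup>2) powr (\<eta> - 1) * (1 - (1 - (norm w)\<^sup>2)) ^ k)))"
    if w: "norm w < 1" "w \<noteq> 0" for w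
  proof -
    define r where "r = norm w"
    define \<sigma> where "\<sigma> = 1 - r\<^sup>2"
    have r: "0 < r" "r < 1" using w by (auto simp: r_def)
    have \<sigma>: "0 < \<sigma>" "\<sigma> \<le> 2 * (1 - r)"
    proof -
      have "\<sigma> = (1 - r) * (1 + r)" by (simp add: \<sigma>_def power2_eq_square algebra_simps)
      moreover have "0 < (1 - r) * (1 + r)" using r by simp
      moreover have "(1 - r) * (1 + r) \<le> (1 - r) * 2" using r by (intro mult_left_mono) auto
      ultimately show "0 < \<sigma>" "\<sigma> \<le> 2 * (1 - r)" by auto
    qed
    \<comment> \<open>The divisor 12 makes the total at most 1/2: the series is at most
      \<open>3 / sqrt (1 - r)\<close>, and
      \<open>sqrt \<sigma> \<le> 2 * sqrt (1 - r)\<close>.\<close>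
    define M where "M k = sqrt \<sigma> / 12 * (r ^ k / sqrt (k + 1))" for k :: nat
    have Mpos: "M k > 0" for k using r \<sigma> by (simp add: M_def)
    have "sqrt \<sigma> \<le> 2 * sqrt (1 - r)"
    proof -
      have "sqrt \<sigma> \<le> sqrt (4 * (1 - r))" using \<sigma> r by (intro real_sqrt_le_mono) linarith
      then show ?thesis by (simp only: real_sqrt_mult real_sqrt_four)
    qed
    have "(\<Sum>k<n. M k) = sqrt \<sigma> / 12 * (\<Sum>k<n. r ^ k / sqrt (k + 1))"
      by (simp add: M_def sum_distrib_left)
    also have "\<dots> \<le> sqrt \<sigma> / 12 * (3 / sqrt (1 - r))"
      using r \<sigma> by (intro mult_left_mono sum_power_div_sqrt_le) auto
    also have "\<dots> \<le> 1 / 2"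
      using \<open>sqrt \<sigma> \<le> 2 * sqrt (1 - r)\<close> r by (simp add: field_simps)
    finally have Msum: "(\<Sum>k<n. M k) \<le> 1 / 2" .
    have "(\<Sum>j<n. norm (f (\<zeta> ^ j * w)) powr p)
        = (\<Sum>j<n. norm (\<Sum>k<n. a k * w ^ k * \<zeta> ^ (j * k)) powr p)"
      by (simp add: f_def power_mult_distrib power_mult [symmetric] mult_ac)
    also have "\<dots> \<le> 4 * n * (\<Sum>k<n. (norm (a k * w ^ k))\<^sup>2 * (norm (a k * w ^ k) / M k) powr (p - 2))"
      unfolding \<zeta>_def by (rule sum_norm_powr_roots_of_unity_le [OF n p Mpos Msum])
    finally have "(\<Sum>j<n. norm (f (\<zeta> ^ j * w)) powr p) * \<sigma> powr (p - 3)
        \<le> 4 * n * (\<Sum>k<n. (norm (a k * w ^ k))\<^sup>2 * (norm (a k * w ^ k) / M k) powr (p - 2)) * \<sigma> powr (p - 3)"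
      by (intro mult_right_mono) auto
    also have "\<dots> = 4 * n * (\<Sum>k<n. (norm (a k * w ^ k))\<^sup>2 * (norm (a k * w ^ k) / M k) powr (p - 2) * \<sigma> powr (p - 3))"
      by (simp add: sum_distrib_right mult.assoc)
    also have "\<dots> = 4 * n * (\<Sum>k<n. 12 powr (p - 2) * (\<alpha> k * (\<sigma> powr (\<eta> - 1) * (1 - \<sigma>) ^ k)))"
    proof (rule arg_cong2 [of _ _ _ _ "(*)"], rule refl, rule sum.cong, rule refl)
      fix k
      define x where "x = norm (a k)"
      have "x \<ge> 0" by (simp add: x_def)
      have sq: "sqrt y powr (p - 2) = y powr \<eta>" if "y > 0" for y
        using that by (simp add: powr_half_sqrt [symmetric] powr_powr \<eta>_def)
      \<comment> \<open>The factor \<open>r ^ k\<close> in \<open>M k\<close> cancels the modulus of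
        \<open>w ^ k\<close>; powers of \<open>r\<close> survive only in the squared factor, as
        \<open>(1 - \<sigma>) ^ k\<close>.\<close>
      have "norm (a k * w ^ k) / M k = 12 * x * sqrt (k + 1) / sqrt \<sigma>"
        using r by (simp add: M_def x_def norm_mult norm_power r_def field_simps)
      also have "\<dots> powr (p - 2) = 12 powr (p - 2) * x powr (p - 2) * (k + 1) powr \<eta> / \<sigma> powr \<eta>"
        using \<open>x \<ge> 0\<close> \<sigma> by (simp add: powr_mult powr_divide sq)
      finally have 1: "(norm (a k * w ^ k) / M k) powr (p - 2)
        = 12 powr (p - 2) * x powr (p - 2) * (k + 1) powr \<eta> / \<sigma> powr \<eta>" .
      have 2: "(norm (a k * w ^ k))\<^sup>2 = x\<^sup>2 * (1 - \<sigma>) ^ k"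
        by (simp add: norm_mult norm_power x_def \<sigma>_def r_def power_mult_distrib
          power_mult [symmetric] mult.commute)
      have 3: "x\<^sup>2 * x powr (p - 2) = x powr p"
        using \<open>x \<ge> 0\<close> p by (cases "x = 0") (simp_all add: powr_diff)
      \<comment> \<open>Since \<open>p - 2 = 2 * \<eta>\<close>, the exponent is
        \<open>p - 3 - \<eta> = \<eta> - 1\<close>, which is integrable at 0 because
        \<open>\<eta> > 0\<close>.\<close>
      have 4: "\<sigma> powr (p - 3) / \<sigma> powr \<eta> = \<sigma> powr (\<eta> - 1)"
        by (simp add: powr_diff [symmetric] \<eta>_def field_simps)
      have "(norm (a k * w ^ k))\<^sup>2 * (norm (a k * w ^ k) / M k) powr (p - 2) * \<sigma> powr (p - 3)
        = 12 powr (p - 2) * ((x\<^sup>2 * x powr (p - 2)) * (k + 1) powr \<eta>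
          * ((\<sigma> powr (p - 3) / \<sigma> powr \<eta>) * (1 - \<sigma>) ^ k))"
        unfolding 1 2 by (simp add: field_simps)
      then show "(norm (a k * w ^ k))\<^sup>2 * (norm (a k * w ^ k) / M k) powr (p - 2) * \<sigma> powr (p - 3)
        = 12 powr (p - 2) * (\<alpha> k * (\<sigma> powr (\<eta> - 1) * (1 - \<sigma>) ^ k))"
        unfolding 3 4 by (simp add: \<alpha>_def x_def)
    qed
    also have "\<dots> = n * (B * (\<Sum>k<n. \<alpha> k * (\<sigma> powr (\<eta> - 1) * (1 - \<sigma>) ^ k)))"
      by (simp add: B_def sum_distrib_left mult_ac)
    finally show ?thesis by (simp add: \<sigma>_def r_def)
  qed
  define J where "J = (\<integral>\<^sup>+w. ennreal (norm (f w) powr p * (1 - (norm w)\<^sup>2) powr (p - 3))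
        * indicator (ball 0 1) w \<partial>lborel)"
  have "n * J = (\<integral>\<^sup>+w. ennreal ((\<Sum>j<n. norm (f (\<zeta> ^ j * w)) powr p) * (1 - (norm w)\<^sup>2) powr (p - 3))
        * indicator (ball 0 1) w \<partial>lborel)"
    unfolding J_def \<zeta>_def
    by (rule nn_integral_disc_rotation_average [where u = "\<lambda>r. (1 - r\<^sup>2) powr (p - 3)"]) (use n in auto)
  also have "\<dots> \<le> (\<integral>\<^sup>+w. ennreal (n * B) * (\<Sum>k<n. ennreal (\<alpha> k)
        * (ennreal ((1 - (norm w)\<^sup>2) powr (\<eta> - 1) * (1 - (1 - (norm w)\<^sup>2)) ^ k)
        * indicator (ball (0 :: complex) 1) w)) \<partial>lborel)"
  proof (rule nn_integral_mono_AE)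
    show "AE w in lborel. ennreal ((\<Sum>j<n. norm (f (\<zeta> ^ j * w)) powr p) * (1 - (norm w)\<^sup>2) powr (p - 3))
        * indicator (ball 0 1) w \<le> ennreal (n * B) * (\<Sum>k<n. ennreal (\<alpha> k)
        * (ennreal ((1 - (norm w)\<^sup>2) powr (\<eta> - 1) * (1 - (1 - (norm w)\<^sup>2)) ^ k)
        * indicator (ball (0 :: complex) 1) w))"
      using AE_lborel_singleton [of "0 :: complex"]
    proof eventually_elim
      case (elim w)
      show ?case
      proof (cases "norm w < 1")
        case True
        have \<alpha>: "\<alpha> k \<ge> 0" for k by (simp add: \<alpha>_def)
        have "ennreal ((\<Sum>j<n. norm (f (\<zeta> ^ j * w)) powr p) * (1 - (norm w)\<^sup>2) powr (p - 3))
          \<le> ennreal (n * B * (\<Sum>k<n. \<alpha> k * ((1 - (norm w)\<^sup>2) powr (\<eta> - 1) * (1 - (1 - (norm w)\<^sup>2)) ^ k)))"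
          using ptw [OF True elim] by (intro ennreal_leI) (simp add: mult.assoc)
        also have "\<dots> = ennreal (n * B) * (\<Sum>k<n. ennreal (\<alpha> k)
          * ennreal ((1 - (norm w)\<^sup>2) powr (\<eta> - 1) * (1 - (1 - (norm w)\<^sup>2)) ^ k))"
          using \<alpha> B by (simp add: ennreal_mult' [symmetric] sum_nonneg ennreal_mult'' [symmetric])
        finally show ?thesis using True by simp
      qed simp
    qed
  qed
  also have "\<dots> = ennreal (n * B) * (\<Sum>k<n. ennreal (\<alpha> k) *
      (\<integral>\<^sup>+w. ennreal ((1 - (norm w)\<^sup>2) powr (\<eta> - 1) * (1 - (1 - (norm w)\<^sup>2)) ^ k)
        * indicator (ball (0 :: complex) 1) w \<partial>lborel))"
    by (simp add: nn_integral_cmult nn_integral_sum)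
  also have "\<dots> = ennreal (n * B) * (\<Sum>k<n. ennreal (\<alpha> k) *
      (pi * (\<integral>\<^sup>+s. ennreal (s powr (\<eta> - 1) * (1 - s) ^ k) * indicator {0<..1} s \<partial>lborel)))"
    by (subst nn_integral_disc_radial) simp_all
  also have "\<dots> \<le> ennreal (n * B) * (\<Sum>k<n. ennreal (\<alpha> k) *
      (pi * ennreal (exp 1 * Gamma \<eta> * (k + 1) powr - \<eta>)))"
    by (intro mult_left_mono sum_mono nn_integral_Beta_le \<eta>) auto
  also have "\<dots> = ennreal (n * B) * (\<Sum>k<n. ennreal (pi * exp 1 * Gamma \<eta> * norm (a k) powr p))"
  proof (rule arg_cong2 [of _ _ _ _ "(*)"], rule refl, rule sum.cong, rule refl)
    fix k
    \<comment> \<open>The growth \<open>(k + 1) powr \<eta>\<close> of \<open>\<alpha> k\<close> is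
      exactly offset by the decay of the Beta integral.\<close>
    have "\<alpha> k * (pi * (exp 1 * Gamma \<eta> * real (k + 1) powr - \<eta>)) = pi * exp 1 * Gamma \<eta> * norm (a k) powr p"
      by (simp add: \<alpha>_def powr_minus add.commute)
    moreover have "ennreal (\<alpha> k) * (ennreal pi * ennreal (exp 1 * Gamma \<eta> * (k + 1) powr - \<eta>))
      = ennreal (\<alpha> k * (pi * (exp 1 * Gamma \<eta> * (k + 1) powr - \<eta>)))"
      by (subst (1 2) ennreal_mult') (simp_all add: \<alpha>_def)
    ultimately show "ennreal (\<alpha> k) * (ennreal pi * ennreal (exp 1 * Gamma \<eta> * (k + 1) powr - \<eta>))
      = ennreal (pi * exp 1 * Gamma \<eta> * norm (a k) powr p)"
      by (simp only:)
  qed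
  also have "\<dots> = n * ennreal (B * pi * exp 1 * Gamma \<eta> * (\<Sum>k<n. norm (a k) powr p))"
    using B Gamma_real_pos [OF \<eta>]
    by (simp add: ennreal_mult' [symmetric] sum_distrib_left [symmetric] mult.assoc ennreal_of_nat_eq_real_of_nat)
  finally show ?thesis
    using n by (simp add: J_def f_def B_def \<eta>_def ennreal_mult_le_mult_iff)
qed

section \<open>Pointwise growth and passage to power series\<close>

text \<open>In place of Hoelder's inequality, each coefficient is split at a height
  \<open>T\<close>: \<open>norm (a k)\<close> is at most \<open>T\<close> or at most
  \<open>norm (a k) powr p * T powr (1 - p)\<close>. The first part sums as a geometric series, the
  second by hypothesis.\<close>

lemma power_series_lp_bound:
  fixes a :: "nat \<Rightarrow> complex" and p :: real
  assumes p: "p > 1" and a: "summable (\<lambda>k. norm (a k) powr p)" and w: "norm w < 1"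
  shows "summable (\<lambda>k. a k * w ^ k)"
    and "norm (\<Sum>k. a k * w ^ k)
      \<le> 2 * (\<Sum>k. norm (a k) powr p) powr (1 / p) * (1 - norm w) powr - (1 - 1 / p)"
proof -
  define S where "S = (\<Sum>k. norm (a k) powr p)"
  define A where "A = S powr (1 / p)"
  define s where "s = 1 - norm w"
  have s: "s > 0" using w by (simp add: s_def)
  have S: "S \<ge> 0" unfolding S_def using a by (intro suminf_nonneg) auto
  have *: "summable (\<lambda>k. a k * w ^ k) \<and>
    norm (\<Sum>k. a k * w ^ k) \<le> 2 * A * s powr - (1 - 1 / p)"
  proof (cases "S = 0")
    case True
    then have "a k = 0" for k
      using suminf_eq_zero_iff [OF a] by (auto simp: S_def)
    then show ?thesis by (simp add: A_def)
  next
    case False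
    then have A: "A > 0" using S by (simp add: A_def)
    \<comment> \<open>This height balances the two contributions \<open>T / s\<close> and
      \<open>T powr (1 - p) * S\<close>: both equal \<open>A * s powr - (1 - 1 / p)\<close>, whence
      the factor 2.\<close>
    define T where "T = A * s powr (1 / p)"
    have T: "T > 0" using A s by (simp add: T_def)
    have split: "norm (a k) \<le> T + norm (a k) powr p * T powr (1 - p)" for k
    proof (cases "norm (a k) \<le> T")
      case True
      then show ?thesis by (intro add_increasing2) auto
    next
      case False
      then have pos: "norm (a k) > 0" using T by linarith
      have "norm (a k) = norm (a k) powr p * norm (a k) powr (1 - p)"
        using pos by (simp add: powr_add [symmetric])
      also have "\<dots> \<le> norm (a k) powr p * T powr (1 - p)"
        using False T p by (intro mult_left_mono powr_mono2') auto
      finally show ?thesis using T by linarith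
    qed
    have le: "norm (a k * w ^ k) \<le> T * norm w ^ k + T powr (1 - p) * norm (a k) powr p" for k
    proof -
      have "norm (a k * w ^ k) \<le> (T + norm (a k) powr p * T powr (1 - p)) * norm w ^ k"
        unfolding norm_mult norm_power by (intro mult_right_mono split) simp
      also have "\<dots> = T * norm w ^ k + (T powr (1 - p) * norm (a k) powr p) * norm w ^ k"
        by (simp add: algebra_simps)
      also have "\<dots> \<le> T * norm w ^ k + (T powr (1 - p) * norm (a k) powr p) * 1"
        using w by (intro add_left_mono mult_left_mono power_le_one) auto
      finally show ?thesis by simp
    qed
    have sums: "(\<lambda>k. T * norm w ^ k + T powr (1 - p) * norm (a k) powr p) sums
        (T * (1 / s) + T powr (1 - p) * S)"
      unfolding s_def S_def using w
      by (intro sums_add sums_mult geometric_sums summable_sums a) simp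
    have summ: "summable (\<lambda>k. norm (a k * w ^ k))"
      by (rule summable_comparison_test' [OF sums_summable [OF sums], of 0]) (use le in simp)
    have "norm (\<Sum>k. a k * w ^ k) \<le> (\<Sum>k. norm (a k * w ^ k))"
      by (rule summable_norm [OF summ])
    also have "\<dots> \<le> T * (1 / s) + T powr (1 - p) * S"
      using sums_le [OF le summable_sums [OF summ] sums] .
    also have "T * (1 / s) = A * s powr - (1 - 1 / p)"
      using s by (simp add: T_def powr_diff)
    also have "T powr (1 - p) * S = A * s powr - (1 - 1 / p)"
    proof -
      have "S = A powr p" using S p by (simp add: A_def powr_powr)
      moreover have "A powr (1 - p) * A powr p = A" using A by (simp add: powr_add [symmetric])
      moreover have "1 / p * (1 - p) = - (1 - 1 / p)" using p by (simp add: field_simps)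
      ultimately show ?thesis
        using A s by (simp add: T_def powr_mult powr_powr mult_ac)
    qed
    finally show ?thesis
      using summable_norm_cancel [OF summ] by simp
  qed
  show "summable (\<lambda>k. a k * w ^ k)" using * by simp
  show "norm (\<Sum>k. a k * w ^ k)
      \<le> 2 * (\<Sum>k. norm (a k) powr p) powr (1 / p) * (1 - norm w) powr - (1 - 1 / p)"
    using * by (simp add: A_def S_def s_def)
qed

text \<open>Fatou's lemma applied to the partial sums, whose integrals are bounded uniformly in
  \<open>n\<close>.\<close>

lemma nn_integral_disc_power_series_le:
  fixes a :: "nat \<Rightarrow> complex" and p :: real
  assumes p: "p > 2" and a: "summable (\<lambda>k. norm (a k) powr p)"
  shows "(\<integral>\<^sup>+w. ennreal (norm (\<Sum>k. a k * w ^ k) powr p * (1 - (norm w)\<^sup>2) powr (p - 3))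
        * indicator (ball 0 1) w \<partial>lborel)
      \<le> ennreal (4 * 12 powr (p - 2) * pi * exp 1 * Gamma ((p - 2) / 2) * (\<Sum>k. norm (a k) powr p))"
proof -
  define C where "C = 4 * 12 powr (p - 2) * pi * exp 1 * Gamma ((p - 2) / 2)"
  have C: "C > 0" using p by (auto simp: C_def intro!: mult_pos_pos Gamma_real_pos)
  define g where "g n w = ennreal (norm (\<Sum>k<n. a k * w ^ k) powr p * (1 - (norm w)\<^sup>2) powr (p - 3))
        * indicator (ball 0 1) w" for n w
  have [measurable]: "ball 0 1 \<in> sets (borel :: complex measure)" by simp
  have [measurable]: "g n \<in> borel_measurable borel" for n unfolding g_def by measurable
  have lim: "(\<lambda>n. g n w) \<longlonglongrightarrow> ennreal (norm (\<Sum>k. a k * w ^ k) powr p * (1 - (norm w)\<^sup>2) powr (p - 3))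
        * indicator (ball 0 1) w" for w
  proof (cases "norm w < 1")
    case True
    have "(\<lambda>n. \<Sum>k<n. a k * w ^ k) \<longlonglongrightarrow> (\<Sum>k. a k * w ^ k)"
      using power_series_lp_bound(1) [OF _ a True] p by (intro summable_LIMSEQ) auto
    then have "(\<lambda>n. norm (\<Sum>k<n. a k * w ^ k) powr p * (1 - (norm w)\<^sup>2) powr (p - 3))
      \<longlonglongrightarrow> norm (\<Sum>k. a k * w ^ k) powr p * (1 - (norm w)\<^sup>2) powr (p - 3)"
      \<comment> \<open>The limit of the norms may be 0; \<open>p > 0\<close> ensures continuity of
        the power there.\<close>
      using p by (intro tendsto_mult tendsto_powr' tendsto_norm tendsto_const) auto
    then show ?thesis using True by (simp add: g_def)
  qed (simp add: g_def)
  have "(\<integral>\<^sup>+w. ennreal (norm (\<Sum>k. a k * w ^ k) powr p * (1 - (norm w)\<^sup>2) powr (p - 3))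
        * indicator (ball 0 1) w \<partial>lborel) = (\<integral>\<^sup>+w. liminf (\<lambda>n. g n w) \<partial>lborel)"
    by (intro nn_integral_cong lim_imp_Liminf [symmetric] lim) simp
  also have "\<dots> \<le> liminf (\<lambda>n. \<integral>\<^sup>+w. g n w \<partial>lborel)"
    by (rule nn_integral_liminf) simp
  also have "\<dots> \<le> limsup (\<lambda>n. \<integral>\<^sup>+w. g n w \<partial>lborel)"
    by (rule Liminf_le_Limsup) simp
  also have "\<dots> \<le> ennreal (C * (\<Sum>k. norm (a k) powr p))"
  proof (intro Limsup_bounded always_eventually allI)
    fix n
    have "(\<integral>\<^sup>+w. g n w \<partial>lborel) \<le> ennreal (C * (\<Sum>k<n. norm (a k) powr p))"
      unfolding g_def C_def by (rule nn_integral_disc_polynomial_le [OF p])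
    also have "\<dots> \<le> ennreal (C * (\<Sum>k. norm (a k) powr p))"
      using a C by (intro ennreal_leI mult_left_mono sum_le_suminf) auto
    finally show "(\<integral>\<^sup>+w. g n w \<partial>lborel) \<le> ennreal (C * (\<Sum>k. norm (a k) powr p))" .
  qed
  finally show ?thesis by (simp add: C_def)
qed

section \<open>From \<open>q = p\<close> to all \<open>q \<ge> p\<close>\<close>

text \<open>A Bochner integral defaults to 0 for a non-integrable function, so integrability is
  asserted along with the inequality. Summability of the \<open>p\<close>-th powers expresses that
  the right-hand side is finite.\<close>

theorem theorem1p4:
  fixes p q :: real
  assumes "2 < p" and "p \<le> q"
  shows "\<exists>C>0. \<forall>a :: nat \<Rightarrow> complex. summable (\<lambda>k. norm (a k) powr p) \<longrightarrow>
    set_integrable lborel (ball 0 1)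
      (\<lambda>w :: complex. norm (\<Sum>k. a k * w ^ k) powr q
         * (1 - (norm w)\<^sup>2) powr (q / conj_exponent p - 2)) \<and>
    (LINT w : ball 0 1 | lborel. norm (\<Sum>k. a k * w ^ k) powr q
         * (1 - (norm w)\<^sup>2) powr (q / conj_exponent p - 2)) powr (1 / q)
      \<le> C * (\<Sum>k. norm (a k) powr p) powr (1 / p)"
proof -
  define \<beta> where "\<beta> = 1 - 1 / p"
  have \<beta>: "0 < \<beta>" "\<beta> < 1" using assms by (auto simp: \<beta>_def)
  define C where "C = 4 * 12 powr (p - 2) * pi * exp 1 * Gamma ((p - 2) / 2)"
  have C: "C > 0" using assms by (auto simp: C_def intro!: mult_pos_pos Gamma_real_pos)
  \<comment> \<open>\<open>C\<close> is the constant for \<open>q = p\<close>, and 4 is the constant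
    of \<open>growth\<close>, raised to the surplus exponent.\<close>
  define K where "K = C * 4 powr (q - p)"
  have K: "K > 0" using C by (simp add: K_def)
  \<comment> \<open>With \<open>\<beta> = 1 / conj_exponent p\<close> one has
    \<open>p * \<beta> = p - 1\<close>. The weight thus splits into the one for \<open>q = p\<close>
    and a power of the weight in \<open>growth\<close>.\<close>
  have expo: "q / conj_exponent p - 2 = (p - 3) + \<beta> * (q - p)"
    using assms by (simp add: conj_exponent_def \<beta>_def field_simps)
  show ?thesis
  proof (intro exI [of _ "K powr (1 / q)"] conjI allI impI)
    show "K powr (1 / q) > 0" using K by simp
  next
    fix a :: "nat \<Rightarrow> complex"
    assume a: "summable (\<lambda>k. norm (a k) powr p)"
    define f where "f w = (\<Sum>k. a k * w ^ k)" for w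
    have [measurable]: "f \<in> borel_measurable borel" unfolding f_def by measurable
    have [measurable]: "ball 0 1 \<in> sets (borel :: complex measure)" by simp
    define S where "S = (\<Sum>k. norm (a k) powr p)"
    have S: "S \<ge> 0" unfolding S_def using a by (intro suminf_nonneg) auto
    define A where "A = S powr (1 / p)"
    have A: "A \<ge> 0" by (simp add: A_def)
    have SA: "S = A powr p" using S assms by (simp add: A_def powr_powr)
    define F where "F w = norm (f w) powr q * (1 - (norm w)\<^sup>2) powr (q / conj_exponent p - 2)" for w
    define G where "G w = indicator (ball 0 1) w *\<^sub>R F w" for w
    have [measurable]: "G \<in> borel_measurable borel" unfolding G_def F_def by measurable
    have G0: "G w \<ge> 0" for w by (simp add: G_def F_def)
    \<comment> \<open>One factor 2 is that of the power series bound; the other bounds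
      \<open>2 powr \<beta>\<close>, which arises from
      \<open>\<sigma> \<le> 2 * (1 - norm w)\<close>.\<close>
    have growth: "norm (f w) * (1 - (norm w)\<^sup>2) powr \<beta> \<le> 4 * A" if w: "norm w < 1" for w
    proof -
      define \<sigma> where "\<sigma> = 1 - (norm w)\<^sup>2"
      have \<sigma>_eq: "\<sigma> = (1 - norm w) * (1 + norm w)"
        by (simp add: \<sigma>_def power2_eq_square algebra_simps)
      have \<sigma>: "\<sigma> > 0" unfolding \<sigma>_eq using w by (intro mult_pos_pos) (auto intro: add_pos_nonneg)
      have "\<sigma> powr \<beta> \<le> (2 * (1 - norm w)) powr \<beta>"
        using \<sigma> \<beta> w mult_left_mono [of "1 + norm w" 2 "1 - norm w"]
        by (intro powr_mono2) (auto simp: \<sigma>_eq)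
      also have "\<dots> = 2 powr \<beta> * (1 - norm w) powr \<beta>"
        using w by (intro powr_mult)
      also have "\<dots> \<le> 2 * (1 - norm w) powr \<beta>"
        using \<beta> powr_mono [of \<beta> 1 "2 :: real"] by (intro mult_right_mono) auto
      finally have "norm (f w) * \<sigma> powr \<beta>
          \<le> (2 * A * (1 - norm w) powr - \<beta>) * (2 * (1 - norm w) powr \<beta>)"
        using power_series_lp_bound(2) [OF _ a w] assms A
        by (intro mult_mono) (auto simp: f_def A_def S_def \<beta>_def)
      also have "\<dots> = 4 * A"
        using w by (simp add: powr_minus)
      finally show ?thesis by (simp add: \<sigma>_def)
    qed
    have "(\<integral>\<^sup>+w. ennreal (G w) \<partial>lborel)
        \<le> (\<integral>\<^sup>+w. ennreal ((4 * A) powr (q - p)) * (ennreal (norm (f w) powr p * (1 - (norm w)\<^sup>2) powr (p - 3))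
          * indicator (ball 0 1) w) \<partial>lborel)"
    proof (rule nn_integral_mono)
      fix w
      show "ennreal (G w) \<le> ennreal ((4 * A) powr (q - p)) * (ennreal (norm (f w) powr p
          * (1 - (norm w)\<^sup>2) powr (p - 3)) * indicator (ball 0 1) w)"
      proof (cases "norm w < 1")
        case True
        define \<sigma> where "\<sigma> = 1 - (norm w)\<^sup>2"
        have \<sigma>: "\<sigma> > 0" using True by (simp add: \<sigma>_def power_less_one_iff)
        \<comment> \<open>For \<open>q = p\<close> the first factor is a \<open>powr 0\<close>,
          which is 0 at base 0 and 1 otherwise; the identity persists because
          \<open>norm (f w) powr p\<close> vanishes there too.\<close>
        have "F w = (norm (f w) * \<sigma> powr \<beta>) powr (q - p) * (norm (f w) powr p * \<sigma> powr (p - 3))"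
          using \<sigma> powr_add [of "norm (f w)" p "q - p"]
          by (simp add: F_def expo \<sigma>_def [symmetric] powr_add powr_mult powr_powr mult_ac)
        also have "\<dots> \<le> (4 * A) powr (q - p) * (norm (f w) powr p * \<sigma> powr (p - 3))"
          using growth [OF True] assms by (intro mult_right_mono powr_mono2) (auto simp: \<sigma>_def)
        finally show ?thesis
          using True by (simp add: G_def \<sigma>_def ennreal_mult' [symmetric] ennreal_leI)
      qed (simp add: G_def)
    qed
    also have "\<dots> = ennreal ((4 * A) powr (q - p)) * (\<integral>\<^sup>+w. ennreal (norm (f w) powr p
        * (1 - (norm w)\<^sup>2) powr (p - 3)) * indicator (ball 0 1) w \<partial>lborel)"
      by (rule nn_integral_cmult) measurable
    also have "\<dots> \<le> ennreal ((4 * A) powr (q - p)) * ennreal (C * S)"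
      unfolding f_def C_def S_def
      by (intro mult_left_mono nn_integral_disc_power_series_le assms a) simp
    also have "\<dots> = ennreal ((4 * A) powr (q - p) * (C * S))"
      by (rule ennreal_mult' [symmetric]) simp
    also have "(4 * A) powr (q - p) * (C * S) = K * A powr q"
      using A powr_add [of A "q - p" p] by (simp add: K_def powr_mult SA mult_ac)
    finally have bound: "(\<integral>\<^sup>+w. ennreal (G w) \<partial>lborel) \<le> ennreal (K * A powr q)" .
    have int: "integrable lborel G"
      using G0 le_less_trans [OF bound ennreal_less_top] by (intro integrableI_nonneg) auto
    have "ennreal (integral\<^sup>L lborel G) \<le> ennreal (K * A powr q)"
      using bound nn_integral_eq_integral [OF int] G0 by simp
    then have le: "integral\<^sup>L lborel G \<le> K * A powr q"
      using K by (subst (asm) ennreal_le_iff) auto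
    show "set_integrable lborel (ball 0 1)
      (\<lambda>w :: complex. norm (\<Sum>k. a k * w ^ k) powr q
         * (1 - (norm w)\<^sup>2) powr (q / conj_exponent p - 2))"
      using int by (simp add: set_integrable_def G_def [abs_def] F_def f_def)
    have "(integral\<^sup>L lborel G) powr (1 / q) \<le> (K * A powr q) powr (1 / q)"
      using le assms G0 by (intro powr_mono2) auto
    also have "\<dots> = K powr (1 / q) * A"
      using K A assms by (simp add: powr_mult powr_powr)
    finally show "(LINT w : ball 0 1 | lborel. norm (\<Sum>k. a k * w ^ k) powr q
         * (1 - (norm w)\<^sup>2) powr (q / conj_exponent p - 2)) powr (1 / q)
      \<le> K powr (1 / q) * (\<Sum>k. norm (a k) powr p) powr (1 / p)"
      by (simp add: set_lebesgue_integral_def G_def [abs_def] F_def f_def A_def S_def)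
  qed
qed

end
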